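(* Let $k$ and $l$ be two positive integers. Let $p_1\in\mathcal{P}_k$ and $p_2\in\mathcal{P}_l$. For any $p'\in\mathcal{P}_{k+l}$ such that $p'\prec p_1\otimes p_2$, there exist $p_1'\prec p_1$ (in $\mathcal{P}_k$) and $p_2'\prec p_2$ (in $\mathcal{P}_l$) such that $p'=p_1'\otimes p_2'$.
   Context: For every $m$, $\mathcal{P}_m$ is the set of partitions of $\{1,\dots,m\}\cup\{1',\dots,m'\}$ ($1,\dots,m$ form the top row, $1',\dots,m'$ the bottom row), and $\mathrm{id}_m=\{\{i,i'\}: i=1,\dots,m\}$. $\mathrm{nc}(p)$ is the number of blocks of $p$, $p\vee p'$ is the finest partition coarser than $p$ and $p'$, and $d(p,p')=\frac12(\mathrm{nc}(p)+\mathrm{nc}(p'))-\mathrm{nc}(p\vee p')$. Composition: to form $p\circ p'$ ($p,p'\in\mathcal{P}_m$), put a diagram of $p'$ above a diagram of $p$ and identify the bottom vertex $i'$ of $p'$ with the top vertex $i$ of $p$ for each $i$; $p\circ p'$ is the partition of the top and bottom rows induced by the connected components of the resulting three-row graph, and $\kappa(p,p')$ is the number of connected components entirely contained in the middle row. Tensor product: for $p\in\mathcal{P}_k$, $q\in\mathcal{P}_l$, $p\otimes q\in\mathcal{P}_{k+l}$ is obtained by placing $q$ to the right of $p$, i.e. the labels $i,i'$ of $q$ become $k+i,(k+i)'$. Relation $\prec$ on $\mathcal{P}_m$: $p'\prec p$ if and only if there exists $p''\in\mathcal{P}_m$ such that $p=p'\circ p''$ and $$d(\mathrm{id}_m,p)=d(\mathrm{id}_m,p')+d(\mathrm{id}_m,p'')-\frac{m+\mathrm{nc}(p)-\mathrm{nc}(p')-\mathrm{nc}(p'')}{2}-\kappa(p',p'').$$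 *)

theory Defs
  imports Complex_Main "HOL-Library.Disjoint_Sets"
begin

datatype vertex = Top nat | Bot nat

definition verts :: "nat \<Rightarrow> vertex set" where
  "verts m = Top ` {1..m} \<union> Bot ` {1..m}"

definition Parts :: "nat \<Rightarrow> vertex set set set" where
  "Parts m = {p. partition_on (verts m) p}"

definition id_part :: "nat \<Rightarrow> vertex set set" where
  "id_part m = (\<lambda>i. {Top i, Bot i}) ` {1..m}"

abbreviation nc :: "vertex set set \<Rightarrow> nat" where
  "nc p \<equiv> card p"

(* refines A p q: p and q are partitions of A and each block of p lies in a block of q,
   that is, q is coarser than p.  That the described object exists and is unique for
   p, q in Parts m is proved below (join_unique). *)
definition join :: "nat \<Rightarrow> vertex set set \<Rightarrow> vertex set set \<Rightarrow> vertex set set" where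
  "join m p q = (THE r. refines (verts m) p r \<and> refines (verts m) q r \<and>
     (\<forall>s. refines (verts m) p s \<and> refines (verts m) q s \<longrightarrow> refines (verts m) r s))"

definition pdist :: "nat \<Rightarrow> vertex set set \<Rightarrow> vertex set set \<Rightarrow> real" where
  "pdist m p q = (real (nc p) + real (nc q)) / 2 - real (nc (join m p q))"

datatype vertex3 = Up nat | Mid nat | Low nat

fun in_upper :: "vertex \<Rightarrow> vertex3" where
  "in_upper (Top i) = Up i"
| "in_upper (Bot i) = Mid i"

fun in_lower :: "vertex \<Rightarrow> vertex3" where
  "in_lower (Top i) = Mid i"
| "in_lower (Bot i) = Low i"

fun outer :: "vertex \<Rightarrow> vertex3" where
  "outer (Top i) = Up i"
| "outer (Bot i) = Low i"

definition verts3 :: "nat \<Rightarrow> vertex3 set" where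
  "verts3 m = Up ` {1..m} \<union> Mid ` {1..m} \<union> Low ` {1..m}"

(* As the diagram of a partition we take the graph in which any two vertices of the same
   block are adjacent.  The second argument is placed above the first. *)
definition edges3 :: "vertex set set \<Rightarrow> vertex set set \<Rightarrow> (vertex3 \<times> vertex3) set" where
  "edges3 p p' = (\<Union>b\<in>p'. in_upper ` b \<times> in_upper ` b) \<union> (\<Union>b\<in>p. in_lower ` b \<times> in_lower ` b)"

definition components3 :: "nat \<Rightarrow> vertex set set \<Rightarrow> vertex set set \<Rightarrow> vertex3 set set" where
  "components3 m p p' = verts3 m // (edges3 p p')\<^sup>*"

definition pcomp :: "nat \<Rightarrow> vertex set set \<Rightarrow> vertex set set \<Rightarrow> vertex set set" where
  "pcomp m p p' = (\<lambda>c. outer -` c) ` components3 m p p' - {{}}"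

definition kappa :: "nat \<Rightarrow> vertex set set \<Rightarrow> vertex set set \<Rightarrow> nat" where
  "kappa m p p' = card {c \<in> components3 m p p'. c \<subseteq> Mid ` {1..m}}"

fun shift :: "nat \<Rightarrow> vertex \<Rightarrow> vertex" where
  "shift k (Top i) = Top (k + i)"
| "shift k (Bot i) = Bot (k + i)"

(* k is the number of columns of the left factor p. *)
definition tensor :: "nat \<Rightarrow> vertex set set \<Rightarrow> vertex set set \<Rightarrow> vertex set set" where
  "tensor k p q = p \<union> (\<lambda>b. shift k ` b) ` q"

definition prec :: "nat \<Rightarrow> vertex set set \<Rightarrow> vertex set set \<Rightarrow> bool" where
  "prec m p' p \<longleftrightarrow> p' \<in> Parts m \<and> p \<in> Parts m \<and>
     (\<exists>p''\<in>Parts m. p = pcomp m p' p'' \<and>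
        pdist m (id_part m) p = pdist m (id_part m) p' + pdist m (id_part m) p''
          - (real m + real (nc p) - real (nc p') - real (nc p'')) / 2
          - real (kappa m p' p''))"

lemma id_part_in_Parts: "id_part m \<in> Parts m"
  unfolding Parts_def id_part_def verts_def
  by (auto intro!: partition_onI simp: disjnt_def)

lemma join_unique:
  assumes "p \<in> Parts m" "q \<in> Parts m"
  shows "\<exists>!r. refines (verts m) p r \<and> refines (verts m) q r \<and>
     (\<forall>s. refines (verts m) p s \<and> refines (verts m) q s \<longrightarrow> refines (verts m) r s)"
proof -
  let ?V = "verts m"
  have P: "partition_on ?V p" and Q: "partition_on ?V q"
    using assms by (auto simp: Parts_def)
  define E where "E = (\<Union>b\<in>p \<union> q. b \<times> b)"
  define r where "r = ?V // E\<^sup>+"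
  have EV: "E \<subseteq> ?V \<times> ?V"
    using P Q unfolding E_def partition_on_def by blast
  have cov: "(x, x) \<in> E" if "x \<in> ?V" for x
    using that P unfolding E_def partition_on_def by blast
  have eq: "equiv ?V (E\<^sup>+)"
  proof (rule equivI)
    show "E\<^sup>+ \<subseteq> ?V \<times> ?V" using EV by (rule trancl_subset_Sigma)
    show "refl_on ?V (E\<^sup>+)" by (rule refl_onI) (use cov in blast)
    have "sym E" unfolding E_def sym_def by blast
    then show "sym (E\<^sup>+)" by (rule sym_trancl)
    show "trans (E\<^sup>+)" by (rule trans_trancl)
  qed
  have R: "partition_on ?V r" unfolding r_def using eq by (rule partition_on_quotient)
  have ref: "refines ?V t r" if T: "partition_on ?V t" and sub: "t \<subseteq> p \<union> q" for t
  proof -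
    have "\<exists>Y\<in>r. b \<subseteq> Y" if b: "b \<in> t" for b
    proof -
      obtain x where x: "x \<in> b" using b T by (metis partition_onD3 ex_in_conv)
      have "x \<in> ?V" using b x T by (auto simp: partition_on_def)
      then have "E\<^sup>+ `` {x} \<in> r" unfolding r_def by (rule quotientI)
      moreover have "b \<subseteq> E\<^sup>+ `` {x}"
      proof
        fix y assume "y \<in> b"
        then have "(x, y) \<in> E" using x b sub unfolding E_def by blast
        then show "y \<in> E\<^sup>+ `` {x}" by blast
      qed
      ultimately show ?thesis by blast
    qed
    then show ?thesis using T R unfolding refines_def by blast
  qed
  have least: "refines ?V r s" if s1: "refines ?V p s" and s2: "refines ?V q s" for s
  proof -
    have S: "partition_on ?V s" using s1 by (auto simp: refines_def)
    have "\<exists>Y\<in>s. c \<subseteq> Y" if c: "c \<in> r" for c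
    proof -
      obtain x where x: "x \<in> ?V" and cx: "c = E\<^sup>+ `` {x}"
        using c unfolding r_def by (auto elim: quotientE)
      obtain Y where Y: "Y \<in> s" "x \<in> Y" using x S by (auto simp: partition_on_def)
      have step: "b \<in> Y" if ab: "(a, b) \<in> E" and aY: "a \<in> Y" for a b
      proof -
        obtain B where B: "B \<in> p \<union> q" "a \<in> B" "b \<in> B" using ab unfolding E_def by blast
        obtain Z where Z: "Z \<in> s" "B \<subseteq> Z" using B(1) s1 s2 unfolding refines_def by blast
        have "Z = Y" using S Z Y B aY unfolding partition_on_def disjoint_def by blast
        then show ?thesis using B Z by blast
      qed
      have "y \<in> Y" if "(x, y) \<in> E\<^sup>+" for y
        using that by (induction rule: trancl_induct) (use Y step in blast)+
      then show ?thesis using Y cx by blast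
    qed
    then show ?thesis using S R unfolding refines_def by blast
  qed
  show ?thesis
  proof (rule ex1I[of _ r])
    show "refines ?V p r \<and> refines ?V q r \<and>
      (\<forall>s. refines ?V p s \<and> refines ?V q s \<longrightarrow> refines ?V r s)"
      using ref[OF P] ref[OF Q] least by blast
  next
    fix s assume "refines ?V p s \<and> refines ?V q s \<and>
      (\<forall>t. refines ?V p t \<and> refines ?V q t \<longrightarrow> refines ?V s t)"
    then show "s = r" using ref[OF P] ref[OF Q] least by (meson Un_upper1 Un_upper2 refines_asym)
  qed
qed

end

theory Submission
  imports Defs
begin

text \<open>
  Write \<open>a q\<close> for the number of blocks of \<open>id_m \<or> q\<close> and \<open>C\<close> for the number of components of the
  three-row graph of \<open>p' \<circ> p''\<close> after all three vertices of each column are connected.  Since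
  \<open>nc p + \<kappa>(p', p'')\<close> is the number of components of the three-row graph, the metric condition in
  \<open>p' \<prec> p\<close> says \<open>nc p + \<kappa> + a p' + a p'' = nc p' + nc p'' + a p\<close>.  Here \<open>\<le>\<close> holds always:
  submodularity of the rank function of graphs gives it with \<open>C\<close> in place of \<open>a p\<close>, and \<open>C \<le> a p\<close>.
  Equality forces \<open>C = a p\<close>, so \<open>p'\<close> and \<open>p''\<close> refine \<open>id_m \<or> p\<close> and hence split wherever \<open>p\<close>
  does.  All terms are additive under tensor products, so equality for a tensor product gives
  equality for both factors.
\<close>

section \<open>Connected components of a relation on a vertex set\<close>

text \<open>The equivalence closure is reflexive on the whole type. The vertex set enters only in
  \<open>classes\<close>, so the same closure serves graphs on different vertex sets.\<close>

definition conn :: "'a rel \<Rightarrow> 'a rel" where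
  "conn R = (R \<union> R\<inverse>)\<^sup>*"

definition classes :: "'a set \<Rightarrow> 'a rel \<Rightarrow> 'a set set" where
  "classes A R = A // conn R"

text \<open>The graph of a partition, complete on each block and with loops, turns joins of
  partitions into unions of relations.\<close>

definition edges :: "'a set set \<Rightarrow> 'a rel" where
  "edges p = (\<Union>b\<in>p. b \<times> b)"

lemma conn_refl [simp]: "(x, x) \<in> conn R"
  by (simp add: conn_def)

lemma conn_sym: "(x, y) \<in> conn R \<Longrightarrow> (y, x) \<in> conn R"
proof -
  have "sym (conn R)" unfolding conn_def by (intro sym_rtrancl) (auto simp: sym_def)
  then show "(x, y) \<in> conn R \<Longrightarrow> (y, x) \<in> conn R" by (auto simp: sym_def)
qed

lemma conn_trans: "(x, y) \<in> conn R \<Longrightarrow> (y, z) \<in> conn R \<Longrightarrow> (x, z) \<in> conn R"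
  unfolding conn_def by (rule rtrancl_trans)

lemma conn_incl: "(x, y) \<in> R \<Longrightarrow> (x, y) \<in> conn R"
  unfolding conn_def by blast

text \<open>Each edge of a path is replaced by a chain in \<open>S\<close>. With \<open>h\<close>
  the identity this compares the closures of two relations on the same vertices.\<close>

lemma conn_map:
  assumes "(x, y) \<in> conn R" and "\<And>x y. (x, y) \<in> R \<Longrightarrow> (h x, h y) \<in> conn S"
  shows "(h x, h y) \<in> conn S"
  using assms(1) unfolding conn_def[of R]
proof (induction rule: rtrancl_induct)
  case (step y z)
  then have "(h y, h z) \<in> conn S" using assms(2) conn_sym by fastforce
  with step show ?case by (blast intro: conn_trans)
qed simp

lemma conn_mono: "R \<subseteq> S \<Longrightarrow> conn R \<subseteq> conn S"
  unfolding conn_def by (intro rtrancl_mono) auto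

lemma conn_closed:
  assumes "(x, y) \<in> conn R" "x \<in> A" and "\<And>x y. (x, y) \<in> R \<Longrightarrow> x \<in> A \<longleftrightarrow> y \<in> A"
  shows "y \<in> A"
  using assms(1) unfolding conn_def
  by (induction rule: rtrancl_induct) (use assms(2,3) in auto)

lemma conn_within:
  assumes "(x, y) \<in> conn R" "x \<in> A" "R \<subseteq> A \<times> A"
  shows "y \<in> A"
  using conn_closed[OF assms(1,2)] assms(3) by auto

lemma conn_class_eq_iff: "conn R `` {x} = conn R `` {y} \<longleftrightarrow> (x, y) \<in> conn R"
proof
  assume "conn R `` {x} = conn R `` {y}"
  moreover have "y \<in> conn R `` {y}" by simp
  ultimately show "(x, y) \<in> conn R" by blast
next
  assume "(x, y) \<in> conn R"
  then show "conn R `` {x} = conn R `` {y}" by (blast intro: conn_sym conn_trans)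
qed

lemma conn_eqI: "R \<subseteq> conn S \<Longrightarrow> S \<subseteq> conn R \<Longrightarrow> conn R = conn S"
  by (intro equalityI subrelI; erule conn_map[where h = "\<lambda>x. x"]) blast+

lemma mem_classesD: "c \<in> classes A R \<Longrightarrow> x \<in> c \<Longrightarrow> c = conn R `` {x}"
  unfolding classes_def by (elim quotientE) (simp add: conn_class_eq_iff)

lemma classesI: "x \<in> A \<Longrightarrow> conn R `` {x} \<in> classes A R"
  unfolding classes_def by (rule quotientI)

lemma classes_conv: "classes A R = (\<lambda>x. conn R `` {x}) ` A"
  unfolding classes_def quotient_def by auto

lemma finite_classes: "finite A \<Longrightarrow> finite (classes A R)"
  unfolding classes_conv by simp

lemma partition_on_classes:
  assumes "R \<subseteq> A \<times> A"
  shows "partition_on A (classes A R)"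
proof (rule partition_onI)
  show "\<Union> (classes A R) = A"
    using assms by (auto simp: classes_conv intro: conn_within)
  have "conn R `` {x} \<noteq> {}" for x using conn_refl[of x R] by blast
  then show "{} \<notin> classes A R" by (auto simp: classes_conv dest: sym)
  fix c d assume "c \<in> classes A R" "d \<in> classes A R" "c \<noteq> d"
  then have "x \<notin> d" if "x \<in> c" for x
    using that mem_classesD[of c A R x] mem_classesD[of d A R x] by auto
  then show "disjnt c d" by (auto simp: disjnt_def)
qed

text \<open>No edge leads from one vertex set to the other, so a path stays on the side where it
  starts.\<close>

lemma classes_Un:
  assumes "A \<inter> B = {}" "R \<subseteq> A \<times> A" "S \<subseteq> B \<times> B"
  shows "classes (A \<union> B) (R \<union> S) = classes A R \<union> classes B S"
proof -
  \<comment> \<open>The sets and relations are quantified afresh so that the claim can be used a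
    second time with the two sides exchanged.\<close>
  have *: "conn (R \<union> S) `` {x} = conn R `` {x}"
    if x: "x \<in> A" and AB: "A \<inter> B = {}" "R \<subseteq> A \<times> A" "S \<subseteq> B \<times> B" for x :: 'a and A B R S
  proof -
    have "y \<in> A \<and> (x, y) \<in> conn R" if "(x, y) \<in> conn (R \<union> S)" for y
      using that unfolding conn_def[of "R \<union> S"]
    proof (induction rule: rtrancl_induct)
      case (step y z)
      then have "(y, z) \<in> R \<union> R\<inverse>" using AB by blast
      then have "(y, z) \<in> conn R" by (auto intro: conn_incl conn_sym)
      with step AB show ?case using conn_trans conn_within by metis
    qed (use x in auto)
    then show ?thesis using conn_mono[of R "R \<union> S"] by blast
  qed
  have "conn (R \<union> S) `` {x} = conn S `` {x}" if "x \<in> B" for x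
    using *[OF that, of A S R] assms by (simp add: Int_commute Un_commute)
  then show ?thesis
    using *[OF _ assms] by (simp add: classes_conv image_Un)
qed

text \<open>By injectivity every edge of the image graph at \<open>f u\<close> lifts to an edge at
  \<open>u\<close>, so a path starting in \<open>f x\<close> lifts to a path starting in
  \<open>x\<close>.\<close>

lemma conn_image_inj:
  assumes "inj f"
  shows "conn (map_prod f f ` R) `` {f x} = f ` (conn R `` {x})"
proof -
  have "\<exists>z. y = f z \<and> (x, z) \<in> conn R" if "(f x, y) \<in> conn (map_prod f f ` R)" for y
    using that unfolding conn_def[of "map_prod f f ` R"]
  proof (induction rule: rtrancl_induct)
    case (step y z)
    then obtain u where u: "y = f u" "(x, u) \<in> conn R" by blast
    with step(2) assms obtain v where "z = f v" "(u, v) \<in> R \<or> (v, u) \<in> R"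
      by (auto simp: inj_eq)
    with u show ?case using conn_incl conn_sym conn_trans by metis
  qed auto
  moreover have "(f x, f y) \<in> conn (map_prod f f ` R)" if "(x, y) \<in> conn R" for y
    using that by (rule conn_map) (auto intro!: conn_incl)
  ultimately show ?thesis by blast
qed

lemma classes_image:
  "inj f \<Longrightarrow> classes (f ` A) (map_prod f f ` R) = (`) f ` classes A R"
  unfolding classes_conv by (simp add: image_image conn_image_inj)

text \<open>The vertices of \<open>B\<close> outside the image are isolated, and each of them adds a
  singleton class.\<close>

lemma card_classes_embed:
  assumes "inj f" "R \<subseteq> A \<times> A" "f ` A \<subseteq> B" "finite B"
  shows "card (classes B (map_prod f f ` R)) = card (classes A R) + card (B - f ` A)"
proof -
  have finA: "finite A" using assms finite_subset finite_imageD inj_on_subset by (metis subset_UNIV)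
  have emp: "classes (B - f ` A) {} = (\<lambda>x. {x}) ` (B - f ` A)"
    by (simp add: classes_conv conn_def Image_def)
  have "classes (f ` A \<union> (B - f ` A)) (map_prod f f ` R \<union> {})
     = classes (f ` A) (map_prod f f ` R) \<union> classes (B - f ` A) {}"
    using assms(2) by (intro classes_Un) auto
  moreover have "f ` A \<union> (B - f ` A) = B" using assms(3) by blast
  ultimately have eq: "classes B (map_prod f f ` R) = (`) f ` classes A R \<union> (\<lambda>x. {x}) ` (B - f ` A)"
    using assms(1) by (simp add: classes_image emp)
  \<comment> \<open>This keeps the image of a class inside \<open>f\<close> followed by
    \<open>A\<close>, so it cannot be one of the new singletons.\<close>
  have "c \<subseteq> A" if "c \<in> classes A R" for c
    using partition_on_classes[OF assms(2)] that by (auto simp: partition_on_def)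
  then have "(`) f ` classes A R \<inter> (\<lambda>x. {x}) ` (B - f ` A) = {}" by blast
  then show ?thesis unfolding eq
    using assms finA by (simp add: card_Un_disjoint finite_classes card_image inj_on_image inj_image_eq_iff inj_on_def)
qed

section \<open>A partition as the components of its block graph\<close>

lemma conn_edges:
  assumes "partition_on A p" "b \<in> p" "x \<in> b"
  shows "conn (edges p) `` {x} = b"
proof -
  have "y \<in> b" if "(x, y) \<in> conn (edges p)" for y
    using that assms(3)
    by (rule conn_closed) (use assms(1,2) in \<open>auto simp: edges_def partition_on_def disjoint_def\<close>)
  then show ?thesis using assms by (auto intro!: conn_incl simp: edges_def)
qed

lemma classes_edges: "partition_on A p \<Longrightarrow> classes A (edges p) = p"
proof (intro equalityI subsetI)
  fix b assume p: "partition_on A p" and b: "b \<in> p"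
  then obtain x where "x \<in> b" by (metis ex_in_conv partition_onD3)
  with p b show "b \<in> classes A (edges p)"
    using conn_edges classesI by (metis UnionI partition_onD1)
next
  fix b assume p: "partition_on A p" and "b \<in> classes A (edges p)"
  then obtain x c where "b = conn (edges p) `` {x}" "x \<in> c" "c \<in> p"
    unfolding classes_conv by (auto simp: partition_on_def)
  with p show "b \<in> p" by (simp add: conn_edges)
qed

lemma edges_subset: "partition_on A p \<Longrightarrow> edges p \<subseteq> A \<times> A"
  by (auto simp: edges_def partition_on_def)

section \<open>Component counts under adding edges and under maps\<close>

text \<open>A path can be shortened so that it uses the new edge at most once: not at all, or in one
  of its two directions.\<close>

lemma conn_insert:
  "(x, y) \<in> conn (insert (a, b) R) \<longleftrightarrow> (x, y) \<in> conn R
     \<or> (x, a) \<in> conn R \<and> (b, y) \<in> conn R \<or> (x, b) \<in> conn R \<and> (a, y) \<in> conn R" (is "?L \<longleftrightarrow> ?R y")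
proof
  assume ?L
  then show "?R y" unfolding conn_def[of "insert (a, b) R"]
  proof (induction rule: rtrancl_induct)
    case (step y z)
    then consider "(y, z) \<in> conn R" | "y = a \<and> z = b" | "y = b \<and> z = a"
      by (auto intro: conn_incl conn_sym)
    then show ?case using step(3)
    proof cases
      case 1
      with step(3) show ?thesis by (blast intro: conn_trans)
    next
      case 2
      with step(3) show ?thesis by (auto intro: conn_trans conn_sym)
    next
      case 3
      with step(3) show ?thesis by (auto intro: conn_trans conn_sym)
    qed
  qed simp
next
  have "(a, b) \<in> conn (insert (a, b) R)" by (simp add: conn_incl)
  moreover have "conn R \<subseteq> conn (insert (a, b) R)" by (rule conn_mono) blast
  moreover assume "?R y"
  ultimately show ?L
    by (elim disjE conjE) (metis (no_types) subsetD conn_trans conn_sym)+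
qed

text \<open>An edge inside a class changes nothing; any other edge merges exactly the classes of its
  two ends.\<close>

lemma card_classes_insert:
  assumes "finite A" "a \<in> A" "b \<in> A"
  shows "card (classes A R)
    = card (classes A (insert (a, b) R)) + (if (a, b) \<in> conn R then 0 else 1)"
proof (cases "(a, b) \<in> conn R")
  case True
  then have "conn (insert (a, b) R) = conn R"
    by (intro conn_eqI) (auto intro: conn_incl)
  with True show ?thesis by (simp add: classes_def)
next
  case False
  let ?a = "conn R `` {a}" and ?b = "conn R `` {b}"
  have ne: "?a \<noteq> ?b" using False by (simp add: conn_class_eq_iff)
  have ins: "conn (insert (a, b) R) `` {x} =
    (if (x, a) \<in> conn R \<or> (x, b) \<in> conn R then ?a \<union> ?b else conn R `` {x})" for x
  proof (rule set_eqI)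
    fix y
    have "(x, y) \<in> conn R \<longleftrightarrow> (z, y) \<in> conn R" if "(x, z) \<in> conn R" for z
      using that by (blast intro: conn_sym conn_trans)
    from this[of a] this[of b] show "y \<in> conn (insert (a, b) R) `` {x} \<longleftrightarrow>
      y \<in> (if (x, a) \<in> conn R \<or> (x, b) \<in> conn R then ?a \<union> ?b else conn R `` {x})"
      by (cases "(x, a) \<in> conn R"; cases "(x, b) \<in> conn R") (simp_all add: conn_insert, blast)
  qed
  have mem: "?a \<in> classes A R" "?b \<in> classes A R" using assms by (auto intro: classesI)
  have "classes A (insert (a, b) R) = insert (?a \<union> ?b) (classes A R - {?a, ?b})"
  proof (intro equalityI subsetI)
    fix c assume "c \<in> classes A (insert (a, b) R)"
    then obtain x where x: "x \<in> A" "c = conn (insert (a, b) R) `` {x}" by (auto simp: classes_conv)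
    show "c \<in> insert (?a \<union> ?b) (classes A R - {?a, ?b})"
      using x classesI[of x A R] by (auto simp: ins conn_class_eq_iff)
  next
    fix c assume c: "c \<in> insert (?a \<union> ?b) (classes A R - {?a, ?b})"
    show "c \<in> classes A (insert (a, b) R)"
    proof (cases "c = ?a \<union> ?b")
      case True
      then have "c = conn (insert (a, b) R) `` {a}" by (simp add: ins)
      with assms(2) show ?thesis by (simp add: classesI)
    next
      case False
      with c obtain x where x: "x \<in> A" "c = conn R `` {x}" "c \<noteq> ?a" "c \<noteq> ?b"
        by (auto simp: classes_conv)
      then have "c = conn (insert (a, b) R) `` {x}" by (auto simp: ins conn_class_eq_iff)
      with x(1) show ?thesis by (simp add: classesI)
    qed
  qed
  \<comment> \<open>A class containing \<open>a\<close> equals \<open>?a\<close>, so the merged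
    class is really new.\<close>
  moreover have "?a \<union> ?b \<notin> classes A R - {?a, ?b}"
    using mem_classesD[of "?a \<union> ?b" A R a] by auto
  \<comment> \<open>This bound keeps the subtraction of natural numbers from being
    truncated.\<close>
  moreover have "card {?a, ?b} \<le> card (classes A R)"
    using mem assms(1) by (intro card_mono) (auto simp: finite_classes)
  ultimately show ?thesis using False mem ne assms(1)
    by (simp add: finite_classes card_Diff_subset)
qed

text \<open>This is submodularity of graph rank. The edges of \<open>E\<close> are added one at a
  time: an edge that merges two classes over the larger relation also merges two over the smaller
  one, so the count over \<open>R\<close> drops at least as much as the count over
  \<open>S\<close>.\<close>

lemma card_classes_submodular:
  assumes A: "finite A" and E: "E \<subseteq> A \<times> A" and RS: "R \<subseteq> S"
  shows "card (classes A S) + card (classes A (R \<union> E)) \<le> card (classes A R) + card (classes A (S \<union> E))"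
proof -
  have "finite E" using A E finite_subset by blast
  then show ?thesis using E
  proof (induction E rule: finite_induct)
    case (insert e E)
    obtain a b where e: "e = (a, b)" by fastforce
    have ab: "a \<in> A" "b \<in> A" using insert.prems e by auto
    have "conn (R \<union> E) \<subseteq> conn (S \<union> E)" using RS by (intro conn_mono) auto
    moreover note card_classes_insert[OF A ab, of "R \<union> E"] card_classes_insert[OF A ab, of "S \<union> E"]
    moreover have "card (classes A S) + card (classes A (R \<union> E))
      \<le> card (classes A R) + card (classes A (S \<union> E))" using insert by simp
    ultimately show ?case by (auto simp: e split: if_splits)
  qed simp
qed

text \<open>The map \<open>h\<close> induces a surjection from the classes of \<open>R\<close> onto
  those of \<open>S\<close>. If the finite counts agree, this surjection is injective, and so
  connectedness of images reflects back to \<open>A\<close>.\<close>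

lemma card_classes_map_le:
  assumes A: "finite A" and h: "\<And>x. x \<in> A \<Longrightarrow> h x \<in> B"
    and R: "\<And>x y. (x, y) \<in> R \<Longrightarrow> (h x, h y) \<in> conn S"
    and onto: "\<And>b. b \<in> B \<Longrightarrow> \<exists>x\<in>A. (h x, b) \<in> conn S"
  shows "card (classes B S) \<le> card (classes A R)"
    and "card (classes B S) = card (classes A R) \<Longrightarrow> x \<in> A \<Longrightarrow> y \<in> A \<Longrightarrow>
      (h x, h y) \<in> conn S \<Longrightarrow> (x, y) \<in> conn R"
proof -
  \<comment> \<open>Saturating the image of a class gives the induced map without a choice of
    representatives.\<close>
  define \<phi> where "\<phi> c = conn S `` (h ` c)" for c
  have \<phi>: "\<phi> (conn R `` {x}) = conn S `` {h x}" for x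
  proof -
    have "(h x, h y) \<in> conn S" if "(x, y) \<in> conn R" for y
      using that R by (rule conn_map)
    then show ?thesis unfolding \<phi>_def using conn_trans by fastforce
  qed
  have im: "\<phi> ` classes A R = classes B S"
  proof -
    have "\<phi> ` classes A R = (\<lambda>x. conn S `` {h x}) ` A"
      by (simp add: classes_conv image_image \<phi>)
    also have "\<dots> = classes B S"
    proof (intro equalityI subsetI)
      fix c assume "c \<in> classes B S"
      then obtain b where b: "b \<in> B" "c = conn S `` {b}" by (auto simp: classes_conv)
      with onto obtain x where "x \<in> A" "(h x, b) \<in> conn S" by blast
      with b show "c \<in> (\<lambda>x. conn S `` {h x}) ` A" by (auto simp: conn_class_eq_iff[symmetric])
    qed (use h in \<open>auto intro: classesI\<close>)
    finally show ?thesis .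
  qed
  show "card (classes B S) \<le> card (classes A R)"
    using A card_image_le[OF finite_classes] by (metis im)
  assume "card (classes B S) = card (classes A R)" and xy: "x \<in> A" "y \<in> A" "(h x, h y) \<in> conn S"
  then have "inj_on \<phi> (classes A R)"
    using A by (intro eq_card_imp_inj_on) (auto simp: im finite_classes)
  moreover have "\<phi> (conn R `` {x}) = \<phi> (conn R `` {y})" using xy by (simp add: \<phi> conn_class_eq_iff)
  ultimately show "(x, y) \<in> conn R"
    using xy by (metis classesI conn_class_eq_iff inj_onD)
qed

section \<open>Joins of partitions as component sets\<close>

lemma finite_verts: "finite (verts m)" and finite_verts3: "finite (verts3 m)"
  by (simp_all add: verts_def verts3_def)

lemma Parts_iff: "p \<in> Parts m \<longleftrightarrow> partition_on (verts m) p"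
  by (simp add: Parts_def)

lemma finite_Parts: "p \<in> Parts m \<Longrightarrow> finite p"
  using finite_elements[OF finite_verts] by (simp add: Parts_iff)

lemma edges_Parts: "p \<in> Parts m \<Longrightarrow> edges p \<subseteq> verts m \<times> verts m"
  by (simp add: Parts_iff edges_subset)

lemma refines_edges: "refines A p q \<Longrightarrow> edges p \<subseteq> edges q"
  unfolding refines_def edges_def by blast

text \<open>This half makes the components of the union of two block graphs a common
  coarsening.\<close>

lemma refines_classes:
  assumes "partition_on A p" "edges p \<subseteq> R" "R \<subseteq> A \<times> A"
  shows "refines A p (classes A R)"
proof -
  have "\<exists>c\<in>classes A R. b \<subseteq> c" if b: "b \<in> p" for b
  proof -
    obtain x where x: "x \<in> b" using assms(1) b by (metis ex_in_conv partition_onD3)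
    have "b = conn (edges p) `` {x}" using conn_edges[OF assms(1) b x] by simp
    also have "\<dots> \<subseteq> conn R `` {x}" using conn_mono[OF assms(2)] by blast
    finally show ?thesis using classesI[of x A R] x b assms(1) by (auto simp: partition_on_def)
  qed
  then show ?thesis using assms by (auto simp: refines_def partition_on_classes)
qed

text \<open>This half makes that common coarsening the finest one.\<close>

lemma classes_refines:
  assumes "partition_on A p" "R \<subseteq> edges p"
  shows "refines A (classes A R) p"
proof -
  have R: "R \<subseteq> A \<times> A" using assms edges_subset by blast
  have "\<exists>b\<in>p. c \<subseteq> b" if "c \<in> classes A R" for c
  proof -
    obtain x where x: "x \<in> A" "c = conn R `` {x}" using \<open>c \<in> classes A R\<close> by (auto simp: classes_conv)
    then have "c \<subseteq> conn (edges p) `` {x}" using conn_mono[OF assms(2)] by blast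
    moreover have "conn (edges p) `` {x} \<in> p"
      using classesI[OF x(1), of "edges p"] assms(1) by (simp add: classes_edges)
    ultimately show ?thesis by blast
  qed
  then show ?thesis using assms(1) R by (simp add: refines_def partition_on_classes)
qed

text \<open>The components of the union of both block graphs satisfy the property that determines
  the join; \<open>join_unique\<close> then identifies the two.\<close>

lemma join_eq_classes:
  assumes "p \<in> Parts m" "q \<in> Parts m"
  shows "join m p q = classes (verts m) (edges p \<union> edges q)"
  unfolding join_def
proof (rule the1_equality[OF join_unique[OF assms]], intro conjI allI impI)
  have sub: "edges p \<union> edges q \<subseteq> verts m \<times> verts m"
    using assms edges_Parts by blast
  show "refines (verts m) p (classes (verts m) (edges p \<union> edges q))"
    and "refines (verts m) q (classes (verts m) (edges p \<union> edges q))"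
    using assms sub by (auto intro!: refines_classes simp: Parts_iff)
  fix s assume s: "refines (verts m) p s \<and> refines (verts m) q s"
  then show "refines (verts m) (classes (verts m) (edges p \<union> edges q)) s"
    using refines_edges by (intro classes_refines) (auto simp: refines_def)
qed

lemma join_in_Parts: "p \<in> Parts m \<Longrightarrow> q \<in> Parts m \<Longrightarrow> join m p q \<in> Parts m"
  using edges_Parts[of p m] edges_Parts[of q m]
  by (simp add: join_eq_classes Parts_iff partition_on_classes)

lemma nc_id_part: "nc (id_part m) = m"
proof -
  have "inj_on (\<lambda>i. {Top i, Bot i}) {1..m}" by (auto simp: inj_on_def doubleton_eq_iff)
  then show ?thesis by (simp add: id_part_def card_image)
qed

section \<open>The three-row graph of a composition\<close>

lemma edges3_conv:
  "edges3 p p' = map_prod in_upper in_upper ` edges p' \<union> map_prod in_lower in_lower ` edges p"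
  unfolding edges3_def edges_def by (simp add: image_UN map_prod_surj_on image_paired_Times)

text \<open>The relation \<open>edges3\<close> is already symmetric, so its reflexive transitive
  closure is \<open>conn\<close>.\<close>

lemma components3_eq_classes: "components3 m p p' = classes (verts3 m) (edges3 p p')"
proof -
  have "(edges3 p p')\<inverse> = edges3 p p'" by (auto simp: edges3_def)
  then show ?thesis by (simp add: components3_def classes_def conn_def)
qed

lemma inj_in_upper: "inj in_upper" and inj_in_lower: "inj in_lower"
proof -
  show "inj in_upper" by (rule injI) (auto elim!: in_upper.elims)
  show "inj in_lower" by (rule injI) (auto elim!: in_lower.elims)
qed

lemma rows_in_verts3:
  "in_upper ` verts m \<subseteq> verts3 m" "in_lower ` verts m \<subseteq> verts3 m" "outer ` verts m \<subseteq> verts3 m"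
  by (auto simp: verts_def verts3_def)

lemma map_prod_image_subset: "R \<subseteq> A \<times> A \<Longrightarrow> f ` A \<subseteq> B \<Longrightarrow> map_prod f f ` R \<subseteq> B \<times> B"
  by auto

lemma edges3_subset:
  assumes "p \<in> Parts m" "p' \<in> Parts m"
  shows "edges3 p p' \<subseteq> verts3 m \<times> verts3 m"
  unfolding edges3_conv
  by (intro Un_least map_prod_image_subset[OF edges_Parts[of _ m]] assms rows_in_verts3)

lemma components3_partition:
  "p \<in> Parts m \<Longrightarrow> p' \<in> Parts m \<Longrightarrow> partition_on (verts3 m) (components3 m p p')"
  by (simp add: components3_eq_classes partition_on_classes edges3_subset)

lemma outer_in_verts3: "outer x \<in> verts3 m \<longleftrightarrow> x \<in> verts m"
  by (cases x) (auto simp: verts_def verts3_def)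

lemma pcomp_in_Parts:
  assumes "p \<in> Parts m" "p' \<in> Parts m"
  shows "pcomp m p p' \<in> Parts m"
proof -
  note P = components3_partition[OF assms]
  show ?thesis unfolding Parts_iff
  proof (rule partition_onI)
    show "\<Union> (pcomp m p p') = verts m"
      using P outer_in_verts3[of _ m] unfolding pcomp_def partition_on_def by blast
    fix b c assume "b \<in> pcomp m p p'" "c \<in> pcomp m p p'" "b \<noteq> c"
    then obtain b' c' where "b = outer -` b'" "c = outer -` c'"
      "b' \<in> components3 m p p'" "c' \<in> components3 m p p'" "b' \<noteq> c'"
      unfolding pcomp_def by blast
    with P show "disjnt b c" unfolding partition_on_def disjoint_def disjnt_def by blast
  qed (simp add: pcomp_def)
qed

text \<open>The components counted by \<open>kappa\<close> are thereby those whose empty trace is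
  discarded in \<open>pcomp\<close>.\<close>

lemma subset_Mid_iff:
  assumes "c \<subseteq> verts3 m"
  shows "c \<subseteq> Mid ` {1..m} \<longleftrightarrow> outer -` c = {}"
proof
  show "outer -` c = {}" if "c \<subseteq> Mid ` {1..m}"
  proof -
    have "outer x \<notin> c" for x using that by (cases x) auto
    then show ?thesis by blast
  qed
  show "c \<subseteq> Mid ` {1..m}" if *: "outer -` c = {}"
  proof
    fix v assume v: "v \<in> c"
    have "outer (Top i) \<notin> c" "outer (Bot i) \<notin> c" for i using * by blast+
    with v assms show "v \<in> Mid ` {1..m}" by (cases v) (auto simp: verts3_def)
  qed
qed

text \<open>A component either lies in the middle row or has a nonempty trace on the outer rows.
  Disjoint components have different nonempty traces, so these traces are counted without
  repetition.\<close>

lemma nc_pcomp_plus_kappa: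
  assumes "p \<in> Parts m" "p' \<in> Parts m"
  shows "nc (pcomp m p p') + kappa m p p' = card (components3 m p p')"
proof -
  let ?C = "components3 m p p'"
  note P = components3_partition[OF assms]
  have fin: "finite ?C" by (simp add: components3_eq_classes finite_classes finite_verts3)
  define I where "I = {c \<in> ?C. outer -` c = {}}"
  have sub: "c \<subseteq> verts3 m" if "c \<in> ?C" for c using P that by (auto simp: partition_on_def)
  have kap: "kappa m p p' = card I"
    unfolding kappa_def I_def using subset_Mid_iff sub by (metis (no_types, lifting))
  have "pcomp m p p' = (\<lambda>c. outer -` c) ` (?C - I)"
    by (auto simp: pcomp_def I_def)
  moreover have "inj_on (\<lambda>c. outer -` c) (?C - I)"
  proof (rule inj_onI)
    fix c d assume cd: "c \<in> ?C - I" "d \<in> ?C - I" "outer -` c = outer -` d"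
    then obtain x where "outer x \<in> c" unfolding I_def by blast
    moreover from this cd(3) have "outer x \<in> d" by blast
    ultimately show "c = d" using P cd(1,2) unfolding partition_on_def disjoint_def by blast
  qed
  ultimately have "nc (pcomp m p p') = card (?C - I)" by (simp add: card_image)
  moreover have "I \<subseteq> ?C" by (auto simp: I_def)
  ultimately show ?thesis using fin kap
    by (metis add.commute card_Diff_subset card_mono finite_subset le_add_diff_inverse)
qed

text \<open>The metric condition of \<^const>\<open>prec\<close>, cleared of denominators and subtraction.\<close>

definition geodesic :: "nat \<Rightarrow> vertex set set \<Rightarrow> vertex set set \<Rightarrow> bool" where
  "geodesic m p p' \<longleftrightarrow>
     card (components3 m p p') + nc (join m (id_part m) p) + nc (join m (id_part m) p')
       = nc p + nc p' + nc (join m (id_part m) (pcomp m p p'))"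

text \<open>With \<open>nc (id_part m) = m\<close> all terms in \<open>m\<close> cancel, and
  \<open>nc p\<close> plus \<open>kappa\<close> becomes the number of components of the three-row
  graph.\<close>

lemma prec_iff_geodesic:
  "prec m p' p \<longleftrightarrow> p' \<in> Parts m \<and> (\<exists>p''\<in>Parts m. p = pcomp m p' p'' \<and> geodesic m p' p'')"
proof -
  have "pdist m (id_part m) p = pdist m (id_part m) p' + pdist m (id_part m) p''
          - (real m + real (nc p) - real (nc p') - real (nc p'')) / 2
          - real (kappa m p' p'') \<longleftrightarrow> geodesic m p' p''"
    if "p' \<in> Parts m" "p'' \<in> Parts m" "p = pcomp m p' p''" for p''
    using nc_pcomp_plus_kappa[OF that(1,2), symmetric] that(3)
    by (auto simp: geodesic_def pdist_def nc_id_part field_simps)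
  then show ?thesis unfolding prec_def using pcomp_in_Parts by blast
qed

section \<open>The inequality behind the metric condition, and its equality case\<close>

text \<open>Two stacked copies of the identity partition: together they connect the three vertices
  of each column.\<close>

definition cols3 :: "nat \<Rightarrow> vertex3 rel" where
  "cols3 m = map_prod in_upper in_upper ` edges (id_part m) \<union> map_prod in_lower in_lower ` edges (id_part m)"

text \<open>A two-row graph leaves one of the three rows untouched, and its \<open>m\<close>
  vertices stay isolated.\<close>

lemma card_classes_row:
  assumes f: "f \<in> {in_upper, in_lower}" and R: "R \<subseteq> verts m \<times> verts m"
  shows "card (classes (verts3 m) (map_prod f f ` R)) = card (classes (verts m) R) + m"
proof -
  have "verts3 m - in_upper ` verts m = Low ` {1..m}" "verts3 m - in_lower ` verts m = Up ` {1..m}"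
    by (auto simp: verts3_def verts_def image_Un image_image)
  then have "card (verts3 m - f ` verts m) = m" using f by (auto simp: card_image inj_on_def)
  moreover have "inj f" "f ` verts m \<subseteq> verts3 m"
    using f inj_in_upper inj_in_lower rows_in_verts3[of m] by blast+
  ultimately show ?thesis using R finite_verts3 by (simp add: card_classes_embed)
qed

text \<open>Submodularity is used twice, introducing the identity edges first in the upper and then
  in the lower copy. In the sum the mixed graph cancels, and so do the contributions
  \<open>m\<close> of the isolated rows.\<close>

lemma geodesic_cols3_le:
  assumes p: "p \<in> Parts m" and p': "p' \<in> Parts m"
  shows "card (components3 m p p') + nc (join m (id_part m) p) + nc (join m (id_part m) p')
       \<le> nc p + nc p' + card (classes (verts3 m) (edges3 p p' \<union> cols3 m))"
proof -
  let ?u = "map_prod in_upper in_upper" and ?l = "map_prod in_lower in_lower"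
  let ?I = "edges (id_part m)" and ?V = "verts3 m"
  note sub = edges_Parts[OF p] edges_Parts[OF p'] edges_Parts[OF id_part_in_Parts, of m]
  have E: "?u ` edges p' \<subseteq> ?V \<times> ?V" "?l ` edges p \<subseteq> ?V \<times> ?V" "?u ` ?I \<subseteq> ?V \<times> ?V"
    by (intro map_prod_image_subset[OF edges_Parts[of _ m]] p p' id_part_in_Parts rows_in_verts3)+
  \<comment> \<open>The lower edges of \<open>p\<close> are added to the upper graph of
    \<open>p'\<close>, without and with the identity.\<close>
  have "card (classes ?V (?u ` (?I \<union> edges p'))) + card (classes ?V (edges3 p p'))
    \<le> card (classes ?V (?u ` edges p')) + card (classes ?V (?u ` (?I \<union> edges p') \<union> ?l ` edges p))"
    unfolding edges3_conv by (rule card_classes_submodular) (use finite_verts3 E in auto)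
  \<comment> \<open>The upper graph, now with the identity, is added to the lower graph of
    \<open>p\<close>, without and with the identity.\<close>
  moreover have "card (classes ?V (?l ` (?I \<union> edges p))) + card (classes ?V (?l ` edges p \<union> ?u ` (?I \<union> edges p')))
    \<le> card (classes ?V (?l ` edges p)) + card (classes ?V (?l ` (?I \<union> edges p) \<union> ?u ` (?I \<union> edges p')))"
    by (rule card_classes_submodular) (use finite_verts3 E in auto)
  moreover have "?l ` (?I \<union> edges p) \<union> ?u ` (?I \<union> edges p') = edges3 p p' \<union> cols3 m"
    by (auto simp: edges3_conv cols3_def)
  moreover have "classes (verts m) (edges p) = p" "classes (verts m) (edges p') = p'"
    using p p' by (simp_all add: Parts_iff classes_edges)
  ultimately show ?thesis
    using sub by (simp add: card_classes_row join_eq_classes id_part_in_Parts p p' components3_eq_classes Un_commute)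
qed

lemma conn_cols3_outer:
  assumes "x \<in> verts m" and "cols3 m \<subseteq> R"
  shows "(outer x, in_upper x) \<in> conn R" "(outer x, in_lower x) \<in> conn R"
proof -
  obtain i where i: "i \<in> {1..m}" "x = Top i \<or> x = Bot i" using assms(1) by (auto simp: verts_def)
  have id: "(Top i, Bot i) \<in> edges (id_part m)" using i by (auto simp: edges_def id_part_def)
  have "(Up i, Mid i) \<in> R" "(Mid i, Low i) \<in> R"
    using assms(2) imageI[OF id, of "map_prod in_upper in_upper"] imageI[OF id, of "map_prod in_lower in_lower"]
    by (auto simp: cols3_def)
  then have "(Up i, Mid i) \<in> conn R" "(Mid i, Low i) \<in> conn R" by (auto intro: conn_incl)
  with i(2) show "(outer x, in_upper x) \<in> conn R" "(outer x, in_lower x) \<in> conn R"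
    by (auto intro: conn_sym conn_trans)
qed

lemma conn_pcomp:
  assumes "(x, y) \<in> edges (pcomp m p p')"
  shows "(outer x, outer y) \<in> conn (edges3 p p')"
proof -
  obtain c where "c \<in> components3 m p p'" "outer x \<in> c" "outer y \<in> c"
    using assms by (auto simp: edges_def pcomp_def)
  then show ?thesis using mem_classesD[of c "verts3 m" "edges3 p p'" "outer x"]
    by (auto simp: components3_eq_classes)
qed

text \<open>The map \<open>outer\<close> sends the graph of the join of the identity and the
  composition to the column-connected three-row graph and reaches every component. The second claim
  is the injectivity that comes with equal counts.\<close>

lemma card_classes_cols3_le:
  assumes p: "p \<in> Parts m" and p': "p' \<in> Parts m"
  defines "F \<equiv> edges3 p p' \<union> cols3 m" and "J \<equiv> edges (id_part m) \<union> edges (pcomp m p p')"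
  shows "card (classes (verts3 m) F) \<le> nc (join m (id_part m) (pcomp m p p'))"
    and "card (classes (verts3 m) F) = nc (join m (id_part m) (pcomp m p p')) \<Longrightarrow>
      x \<in> verts m \<Longrightarrow> y \<in> verts m \<Longrightarrow> (outer x, outer y) \<in> conn F \<Longrightarrow> (x, y) \<in> conn J"
proof -
  have Jeq: "join m (id_part m) (pcomp m p p') = classes (verts m) J"
    by (simp add: J_def join_eq_classes pcomp_in_Parts p p' id_part_in_Parts)
  have out: "outer z \<in> verts3 m" if "z \<in> verts m" for z using that by (simp add: outer_in_verts3)
  have hom: "(outer a, outer b) \<in> conn F" if "(a, b) \<in> J" for a b
  proof (cases "(a, b) \<in> edges (id_part m)")
    case True
    then have "a \<in> verts m" "b \<in> verts m" using edges_Parts[OF id_part_in_Parts, of m] by auto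
    \<comment> \<open>The upper copy of an identity edge stays within one column, and the columns
      link its ends to the outer vertices.\<close>
    moreover have "(in_upper a, in_upper b) \<in> conn F"
      using True imageI[OF True, of "map_prod in_upper in_upper"]
      by (intro conn_incl) (auto simp: F_def cols3_def)
    ultimately show ?thesis
      using conn_cols3_outer(1)[of _ m F] conn_sym conn_trans unfolding F_def by (metis Un_upper2)
  next
    case False
    then show ?thesis using that conn_pcomp[of a b m p p'] conn_mono[of "edges3 p p'" F]
      by (auto simp: F_def J_def)
  qed
  \<comment> \<open>Upper and lower vertices are outer themselves; a middle vertex is reached from
    the top of its column.\<close>
  have onto: "\<exists>a\<in>verts m. (outer a, v) \<in> conn F" if v: "v \<in> verts3 m" for v
  proof -
    obtain i where i: "i \<in> {1..m}" "v = Up i \<or> v = Mid i \<or> v = Low i"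
      using v unfolding verts3_def by blast
    then have "Top i \<in> verts m" "Bot i \<in> verts m" by (auto simp: verts_def)
    moreover from this have "(outer (Top i), Mid i) \<in> conn F"
      using conn_cols3_outer(2)[of "Top i" m F] by (simp add: F_def)
    moreover have "(outer (Top i), Up i) \<in> conn F" "(outer (Bot i), Low i) \<in> conn F" by simp_all
    ultimately show ?thesis using i(2) by blast
  qed
  show "card (classes (verts3 m) F) \<le> nc (join m (id_part m) (pcomp m p p'))"
    unfolding Jeq by (rule card_classes_map_le(1)[of _ outer]) (use finite_verts out hom onto in auto)
  show "(x, y) \<in> conn J" if "card (classes (verts3 m) F) = nc (join m (id_part m) (pcomp m p p'))"
    "x \<in> verts m" "y \<in> verts m" "(outer x, outer y) \<in> conn F"
    using that unfolding Jeq by (intro card_classes_map_le(2)[of _ outer, OF finite_verts out hom onto]) auto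
qed

text \<open>Needed for all pairs, since it later separates one equality for a tensor product into
  one for each factor.\<close>

lemma geodesic_le:
  assumes "p \<in> Parts m" "p' \<in> Parts m"
  shows "card (components3 m p p') + nc (join m (id_part m) p) + nc (join m (id_part m) p')
       \<le> nc p + nc p' + nc (join m (id_part m) (pcomp m p p'))"
  using geodesic_cols3_le[OF assms] card_classes_cols3_le(1)[OF assms] by linarith

text \<open>Equality overall forces equality in \<open>card_classes_cols3_le\<close>, so
  \<open>outer\<close> reflects connectedness. An edge of \<open>p\<close> or \<open>p'\<close> is
  an edge of the three-row graph, and the columns carry it to the outer vertices.\<close>

lemma geodesic_refines:
  assumes p: "p \<in> Parts m" and p': "p' \<in> Parts m" and g: "geodesic m p p'"
    and xy: "(x, y) \<in> edges p \<union> edges p'"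
  shows "(x, y) \<in> conn (edges (id_part m) \<union> edges (pcomp m p p'))"
proof (rule card_classes_cols3_le(2)[OF p p'])
  let ?F = "edges3 p p' \<union> cols3 m"
  show "card (classes (verts3 m) ?F) = nc (join m (id_part m) (pcomp m p p'))"
    using geodesic_cols3_le[OF p p'] card_classes_cols3_le(1)[OF p p'] g
    unfolding geodesic_def by linarith
  show x: "x \<in> verts m" and y: "y \<in> verts m" using xy edges_Parts p p' by blast+
  have "(in_lower x, in_lower y) \<in> ?F \<or> (in_upper x, in_upper y) \<in> ?F"
    using xy by (force simp: edges3_conv)
  then show "(outer x, outer y) \<in> conn ?F"
    using conn_cols3_outer[OF x, of ?F] conn_cols3_outer[OF y, of ?F] conn_incl conn_trans conn_sym
    by (metis Un_upper2)
qed

section \<open>Tensor products: decomposition and additivity\<close>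

fun shift3 :: "nat \<Rightarrow> vertex3 \<Rightarrow> vertex3" where
  "shift3 k (Up i) = Up (k + i)"
| "shift3 k (Mid i) = Mid (k + i)"
| "shift3 k (Low i) = Low (k + i)"

lemma inj_shift: "inj (shift k)" and inj_shift3: "inj (shift3 k)"
proof -
  show "inj (shift k)" by (rule injI) (auto elim!: shift.elims)
  show "inj (shift3 k)" by (rule injI) (auto elim!: shift3.elims)
qed

lemma shift3_row:
  "in_upper (shift k x) = shift3 k (in_upper x)"
  "in_lower (shift k x) = shift3 k (in_lower x)"
  "outer (shift k x) = shift3 k (outer x)"
  by (cases x; simp)+

lemma atLeastAtMost_add: "{1..k + l} = {1..k} \<union> (+) k ` {1..l::nat}"
  by auto

lemma verts_add: "verts (k + l) = verts k \<union> shift k ` verts l"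
  by (simp only: verts_def atLeastAtMost_add image_Un image_image shift.simps Un_ac)

lemma verts3_add: "verts3 (k + l) = verts3 k \<union> shift3 k ` verts3 l"
  by (simp only: verts3_def atLeastAtMost_add image_Un image_image shift3.simps Un_ac)

lemma verts_disjoint: "verts k \<inter> shift k ` verts l = {}"
  by (auto simp: verts_def)

lemma verts3_disjoint: "verts3 k \<inter> shift3 k ` verts3 l = {}"
  by (auto simp: verts3_def)

lemma edges_tensor: "edges (tensor k p q) = edges p \<union> map_prod (shift k) (shift k) ` edges q"
  by (simp add: edges_def tensor_def image_UN image_paired_Times map_prod_surj_on)

lemma classes_verts_add:
  assumes "R \<subseteq> verts k \<times> verts k" "S \<subseteq> verts l \<times> verts l"
  shows "classes (verts (k + l)) (R \<union> map_prod (shift k) (shift k) ` S)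
    = tensor k (classes (verts k) R) (classes (verts l) S)"
  using assms unfolding verts_add tensor_def
  by (subst classes_Un)
    (auto simp: classes_image[OF inj_shift] verts_disjoint intro!: map_prod_image_subset)

lemma tensor_in_Parts:
  assumes "p \<in> Parts k" "q \<in> Parts l"
  shows "tensor k p q \<in> Parts (k + l)"
proof -
  note sub = edges_Parts[OF assms(1)] edges_Parts[OF assms(2)]
  have "edges p \<union> map_prod (shift k) (shift k) ` edges q \<subseteq> verts (k + l) \<times> verts (k + l)"
    using sub by (fastforce simp: verts_add)
  from partition_on_classes[OF this] show ?thesis
    using assms by (simp add: classes_verts_add[OF sub] Parts_iff classes_edges)
qed

lemma Parts_block: "p \<in> Parts m \<Longrightarrow> b \<in> p \<Longrightarrow> b \<subseteq> verts m \<and> b \<noteq> {}"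
  by (auto simp: Parts_iff partition_on_def)

text \<open>The factors are recovered as the blocks on the left and on the right. Blocks are
  nonempty and the two sides are disjoint, so no block counts for both.\<close>

lemma tensor_inject:
  assumes "p \<in> Parts k" "p' \<in> Parts k" "q \<in> Parts l" "q' \<in> Parts l"
    and eq: "tensor k p q = tensor k p' q'"
  shows "p = p'" "q = q'"
proof -
  have left: "{b \<in> tensor k p q. b \<subseteq> verts k} = p"
    and right: "{b \<in> tensor k p q. b \<subseteq> shift k ` verts l} = (`) (shift k) ` q"
    if "p \<in> Parts k" "q \<in> Parts l" for p q
  proof -
    have p: "b \<subseteq> verts k \<and> \<not> b \<subseteq> shift k ` verts l" if "b \<in> p" for b
      using Parts_block[OF \<open>p \<in> Parts k\<close> that] verts_disjoint[of k l] by blast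
    have q: "shift k ` c \<subseteq> shift k ` verts l \<and> \<not> shift k ` c \<subseteq> verts k" if "c \<in> q" for c
      using Parts_block[OF \<open>q \<in> Parts l\<close> that] verts_disjoint[of k l] by blast
    show "{b \<in> tensor k p q. b \<subseteq> verts k} = p"
      using p q unfolding tensor_def by blast
    show "{b \<in> tensor k p q. b \<subseteq> shift k ` verts l} = (`) (shift k) ` q"
      using p q unfolding tensor_def by blast
  qed
  show "p = p'" using left[of p q] left[of p' q'] assms by simp
  have "(`) (shift k) ` q = (`) (shift k) ` q'" using right[of p q] right[of p' q'] assms by simp
  moreover have "inj ((`) (shift k))" by (simp add: inj_def inj_image_eq_iff[OF inj_shift])
  ultimately show "q = q'" by (simp add: inj_image_eq_iff)
qed

lemma nc_tensor:
  assumes "p \<in> Parts k" "q \<in> Parts l"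
  shows "nc (tensor k p q) = nc p + nc q"
proof -
  have "p \<inter> (`) (shift k) ` q = {}"
    using Parts_block[OF assms(1)] Parts_block[OF assms(2)] verts_disjoint[of k l] by blast
  moreover have "inj ((`) (shift k))" by (simp add: inj_def inj_image_eq_iff[OF inj_shift])
  ultimately show ?thesis using finite_Parts[OF assms(1)] finite_Parts[OF assms(2)]
    by (simp add: tensor_def card_Un_disjoint card_image inj_on_subset)
qed

text \<open>If no block straddles the two groups of columns, the blocks on each side partition that
  side; those on the right are shifted back.\<close>

lemma tensor_decompose:
  assumes p: "p \<in> Parts (k + l)" and split: "\<And>b. b \<in> p \<Longrightarrow> b \<subseteq> verts k \<or> b \<subseteq> shift k ` verts l"
  obtains p1 p2 where "p1 \<in> Parts k" "p2 \<in> Parts l" "p = tensor k p1 p2"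
proof -
  define p1 where "p1 = {b \<in> p. b \<subseteq> verts k}"
  define p2 where "p2 = (\<lambda>b. shift k -` b) ` {b \<in> p. b \<subseteq> shift k ` verts l}"
  have P: "\<Union> p = verts k \<union> shift k ` verts l" "\<And>b c. b \<in> p \<Longrightarrow> c \<in> p \<Longrightarrow> b \<noteq> c \<Longrightarrow> b \<inter> c = {}" "{} \<notin> p"
    using p by (auto simp: Parts_iff partition_on_def disjoint_def verts_add)
  have "\<Union> p1 = verts k"
  proof
    show "verts k \<subseteq> \<Union> p1"
    proof
      fix x assume x: "x \<in> verts k"
      then obtain b where b: "x \<in> b" "b \<in> p" using P(1) by blast
      then have "b \<subseteq> verts k" using split[OF b(2)] x verts_disjoint[of k l] by blast
      with b show "x \<in> \<Union> p1" by (auto simp: p1_def)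
    qed
  qed (auto simp: p1_def)
  then have "p1 \<in> Parts k"
    using P unfolding Parts_iff by (intro partition_onI) (auto simp: p1_def disjnt_def)
  \<comment> \<open>Shifting back loses nothing for blocks inside the range of the shift.\<close>
  moreover have inv: "shift k ` (shift k -` b) = b" if "b \<subseteq> shift k ` verts l" for b
    using that by blast
  have "p2 \<in> Parts l" unfolding Parts_iff
  proof (rule partition_onI)
    show "\<Union> p2 = verts l"
    proof
      show "\<Union> p2 \<subseteq> verts l" using inj_shift[of k] by (fastforce simp: p2_def inj_def)
      show "verts l \<subseteq> \<Union> p2"
      proof
        fix x assume x: "x \<in> verts l"
        then obtain b where b: "shift k x \<in> b" "b \<in> p" using P(1) by blast
        then have "b \<subseteq> shift k ` verts l" using split[OF b(2)] x verts_disjoint[of k l] by blast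
        with b show "x \<in> \<Union> p2" by (auto simp: p2_def)
      qed
    qed
    show "{} \<notin> p2"
    proof
      assume "{} \<in> p2"
      then obtain b where b: "b \<in> p" "b \<subseteq> shift k ` verts l" "shift k -` b = {}"
        by (auto simp only: p2_def)
      with inv[OF b(2)] P(3) show False by simp
    qed
    fix b c assume bc: "b \<in> p2" "c \<in> p2" "b \<noteq> c"
    obtain b' where b': "b' \<in> p" "b = shift k -` b'" using bc(1) by (auto simp only: p2_def)
    obtain c' where c': "c' \<in> p" "c = shift k -` c'" using bc(2) by (auto simp only: p2_def)
    have "b' \<inter> c' = {}" using P(2)[OF b'(1) c'(1)] bc(3) b' c' by blast
    then show "disjnt b c" unfolding disjnt_def b'(2) c'(2) by blast
  qed
  moreover have "p = tensor k p1 p2"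
  proof -
    have "(`) (shift k) ` p2 = (\<lambda>b. b) ` {b \<in> p. b \<subseteq> shift k ` verts l}"
      unfolding p2_def image_image by (intro image_cong refl inv) simp
    then show ?thesis using split unfolding tensor_def p1_def by blast
  qed
  ultimately show ?thesis using that by blast
qed

lemma join_tensor:
  assumes "p \<in> Parts k" "p' \<in> Parts k" "q \<in> Parts l" "q' \<in> Parts l"
  shows "join (k + l) (tensor k p q) (tensor k p' q') = tensor k (join k p p') (join l q q')"
proof -
  have "edges (tensor k p q) \<union> edges (tensor k p' q')
    = (edges p \<union> edges p') \<union> map_prod (shift k) (shift k) ` (edges q \<union> edges q')"
    by (auto simp: edges_tensor)
  moreover have "edges p \<union> edges p' \<subseteq> verts k \<times> verts k" "edges q \<union> edges q' \<subseteq> verts l \<times> verts l"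
    using assms by (auto dest!: edges_Parts)
  ultimately show ?thesis
    using assms by (simp only: join_eq_classes tensor_in_Parts classes_verts_add)
qed

lemma id_part_add: "id_part (k + l) = tensor k (id_part k) (id_part l)"
  by (simp only: id_part_def tensor_def atLeastAtMost_add image_Un image_image image_insert image_empty shift.simps)

text \<open>The row embeddings commute with the shifts, so the three-row graph is a disjoint union
  of a left part and a shifted right part.\<close>

lemma components3_tensor:
  assumes "p \<in> Parts k" "p' \<in> Parts k" "q \<in> Parts l" "q' \<in> Parts l"
  shows "components3 (k + l) (tensor k p q) (tensor k p' q')
    = components3 k p p' \<union> (`) (shift3 k) ` components3 l q q'"
proof -
  have "edges3 (tensor k p q) (tensor k p' q')
    = edges3 p p' \<union> map_prod (shift3 k) (shift3 k) ` edges3 q q'"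
    by (simp add: edges3_conv edges_tensor image_Un image_image map_prod_def case_prod_beta shift3_row Un_ac)
  moreover note sub = edges3_subset[OF assms(1,2)] edges3_subset[OF assms(3,4)]
  moreover have "map_prod (shift3 k) (shift3 k) ` edges3 q q' \<subseteq> shift3 k ` verts3 l \<times> shift3 k ` verts3 l"
    using sub(2) by (rule map_prod_image_subset) simp
  ultimately show ?thesis unfolding components3_eq_classes verts3_add
    by (simp add: classes_Un verts3_disjoint classes_image[OF inj_shift3])
qed

lemma card_components3_tensor:
  assumes "p \<in> Parts k" "p' \<in> Parts k" "q \<in> Parts l" "q' \<in> Parts l"
  shows "card (components3 (k + l) (tensor k p q) (tensor k p' q'))
    = card (components3 k p p') + card (components3 l q q')"
proof -
  note P = components3_partition[OF assms(1,2)] components3_partition[OF assms(3,4)]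
  have "c \<subseteq> verts3 k \<and> c \<noteq> {}" if "c \<in> components3 k p p'" for c
    using that P(1) by (auto simp: partition_on_def)
  moreover have "c \<subseteq> verts3 l" if "c \<in> components3 l q q'" for c
    using that P(2) by (auto simp: partition_on_def)
  ultimately have "components3 k p p' \<inter> (`) (shift3 k) ` components3 l q q' = {}"
    using verts3_disjoint[of k l] by blast
  moreover have "inj ((`) (shift3 k))" by (simp add: inj_def inj_image_eq_iff[OF inj_shift3])
  ultimately show ?thesis using finite_elements[OF finite_verts3 P(1)] finite_elements[OF finite_verts3 P(2)]
    by (simp add: components3_tensor assms card_Un_disjoint card_image inj_on_subset)
qed

text \<open>Components split by side, and taking the outer trace commutes with shifting.\<close>

lemma pcomp_tensor:
  assumes "p \<in> Parts k" "p' \<in> Parts k" "q \<in> Parts l" "q' \<in> Parts l"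
  shows "pcomp (k + l) (tensor k p q) (tensor k p' q') = tensor k (pcomp k p p') (pcomp l q q')"
proof -
  have vim: "outer -` shift3 k ` c = shift k ` (outer -` c)" for c
  proof -
    have "x \<in> shift k ` (outer -` c)" if "outer x = shift3 k v" "v \<in> c" for x v
    proof -
      have "\<exists>y. outer y = v \<and> shift k y = x"
        using that(1) by (cases x; cases v) (auto intro: exI[of _ "Top _"] exI[of _ "Bot _"])
      with that(2) show ?thesis by blast
    qed
    then show ?thesis by (auto simp: shift3_row)
  qed
  have "(\<lambda>c. outer -` c) ` (`) (shift3 k) ` components3 l q q'
      = (`) (shift k) ` (\<lambda>c. outer -` c) ` components3 l q q'"
    by (simp add: image_image vim)
  then have "pcomp (k + l) (tensor k p q) (tensor k p' q')
      = (\<lambda>c. outer -` c) ` components3 k p p' \<union> (`) (shift k) ` (\<lambda>c. outer -` c) ` components3 l q q' - {{}}"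
    unfolding pcomp_def components3_tensor[OF assms] image_Un by simp
  \<comment> \<open>A shifted trace is empty only if the trace is, so the empty set may be removed
    before or after shifting.\<close>
  also have "\<dots> = tensor k (pcomp k p p') (pcomp l q q')"
    unfolding tensor_def pcomp_def by auto
  finally show ?thesis .
qed

text \<open>The condition for the tensor product is the sum of those for the factors. Each factor
  satisfies the inequality \<open>geodesic_le\<close>, so equality of the sums forces both
  equalities.\<close>

lemma geodesic_tensor:
  assumes P: "p \<in> Parts k" "p' \<in> Parts k" "q \<in> Parts l" "q' \<in> Parts l"
    and "geodesic (k + l) (tensor k p q) (tensor k p' q')"
  shows "geodesic k p p'" "geodesic l q q'"
proof -
  have "nc (join (k + l) (id_part (k + l)) (tensor k r s))
      = nc (join k (id_part k) r) + nc (join l (id_part l) s)" if "r \<in> Parts k" "s \<in> Parts l" for r s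
    using that by (simp add: id_part_add join_tensor id_part_in_Parts nc_tensor[of _ k _ l] join_in_Parts)
  then show "geodesic k p p'" "geodesic l q q'"
    using assms(5) geodesic_le[OF P(1,2)] geodesic_le[OF P(3,4)] pcomp_in_Parts[OF P(1,2)] pcomp_in_Parts[OF P(3,4)]
    by (simp_all add: geodesic_def P card_components3_tensor pcomp_tensor nc_tensor[of _ k _ l])
qed

section \<open>Splitting both factors of a geodesic composition\<close>

text \<open>By \<open>geodesic_refines\<close> a block of either factor is connected in the graph of
  the identity and the composition. Both of these are tensor products, so no edge of that graph
  crosses between the sides.\<close>

lemma geodesic_factor_splits:
  assumes "p1 \<in> Parts k" "p2 \<in> Parts l" and p: "p \<in> Parts (k + l)" and p': "p' \<in> Parts (k + l)"
    and comp: "pcomp (k + l) p p' = tensor k p1 p2" and g: "geodesic (k + l) p p'"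
    and b: "b \<in> p \<union> p'"
  shows "b \<subseteq> verts k \<or> b \<subseteq> shift k ` verts l"
proof -
  let ?J = "edges (id_part (k + l)) \<union> edges (tensor k p1 p2)"
  have J: "?J \<subseteq> verts k \<times> verts k \<union> (shift k ` verts l) \<times> (shift k ` verts l)"
    using assms(1,2) edges_Parts[OF id_part_in_Parts] edges_Parts
    unfolding id_part_add edges_tensor by fastforce
  have side: "x \<in> verts k \<longleftrightarrow> y \<in> verts k" if "x \<in> b" "y \<in> b" for x y
  proof -
    have c: "(x, y) \<in> conn ?J"
      using geodesic_refines[OF p p' g, of x y] that b by (auto simp: comp edges_def)
    have s: "(u, v) \<in> ?J \<Longrightarrow> u \<in> verts k \<longleftrightarrow> v \<in> verts k" for u v
      using J verts_disjoint[of k l] by blast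
    \<comment> \<open>The reversed path supplies the second implication.\<close>
    show ?thesis using conn_closed[OF c _ s] conn_closed[OF conn_sym[OF c] _ s] by blast
  qed
  have "b \<subseteq> verts k \<union> shift k ` verts l"
    using b Parts_block[OF p] Parts_block[OF p'] unfolding verts_add by blast
  with side show ?thesis by blast
qed

theorem lemma3p7:
  fixes k l :: nat and p1 p2 p' :: "vertex set set"
  assumes "k > 0" and "l > 0"
    and "p1 \<in> Parts k" and "p2 \<in> Parts l"
    and "p' \<in> Parts (k + l)"
    and "prec (k + l) p' (tensor k p1 p2)"
  shows "\<exists>p1' p2'. prec k p1' p1 \<and> prec l p2' p2 \<and> p' = tensor k p1' p2'"
proof -
  obtain p'' where p'': "p'' \<in> Parts (k + l)" "tensor k p1 p2 = pcomp (k + l) p' p''"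
    and g: "geodesic (k + l) p' p''"
    using assms(6) by (auto simp: prec_iff_geodesic)
  \<comment> \<open>This covers the blocks of \<open>p'\<close> and \<open>p''\<close> alike, so
    both decompose.\<close>
  note split = geodesic_factor_splits[OF assms(3,4,5) p''(1) p''(2)[symmetric] g]
  obtain q1 q2 where q: "q1 \<in> Parts k" "q2 \<in> Parts l" "p' = tensor k q1 q2"
    using tensor_decompose[OF assms(5)] split by blast
  obtain r1 r2 where r: "r1 \<in> Parts k" "r2 \<in> Parts l" "p'' = tensor k r1 r2"
    using tensor_decompose[OF p''(1)] split by blast
  \<comment> \<open>Composition acts factor by factor; uniqueness of tensor factors then identifies
    \<open>p1\<close> and \<open>p2\<close>.\<close>
  have "tensor k p1 p2 = tensor k (pcomp k q1 r1) (pcomp l q2 r2)"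
    using p''(2) by (simp add: q r pcomp_tensor)
  then have "p1 = pcomp k q1 r1" "p2 = pcomp l q2 r2"
    using tensor_inject assms(3,4) pcomp_in_Parts q r by metis+
  moreover have "geodesic k q1 r1" "geodesic l q2 r2"
    using geodesic_tensor[OF q(1) r(1) q(2) r(2)] g by (simp_all add: q r)
  ultimately have "prec k q1 p1" "prec l q2 p2"
    using q r unfolding prec_iff_geodesic by blast+
  with q(3) show ?thesis by blast
qed

end
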